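(* Let $A, B\in\mathcal{M}_n$ be positive definite matrices. Then for $j=1,2,\ldots,n$, $$s_j\left(A^{\frac12}B^{\frac12}\right)\le s_j\left((A\natural B)\oplus (A\sharp B)\right).$$
   Context: $\mathcal{M}_n$ is the algebra of $n\times n$ complex matrices. $s_j(X)$ denotes the $j$-th singular value of $X$, arranged in decreasing order counting multiplicities. $X\oplus Y$ is the block diagonal $2n\times 2n$ matrix with diagonal blocks $X,Y$. For positive definite $A,B$: $A\sharp B:=A^{\frac12}\left(A^{-\frac12}BA^{-\frac12}\right)^{\frac12}A^{\frac12}$ and $A\natural B:=A^{\frac12}\left(B^{\frac12}A^{-1}B^{\frac12}\right)^{\frac12}A^{\frac12}$. *)

theory Defs
  imports "Jordan_Normal_Form.Schur_Decomposition" "Jordan_Normal_Form.Gauss_Jordan_Elimination"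
    "HOL-Computational_Algebra.Fundamental_Theorem_Algebra"
begin

definition hermitian_mat :: "complex mat \<Rightarrow> bool" where
  "hermitian_mat A \<longleftrightarrow> square_mat A \<and> mat_adjoint A = A"

(* For Hermitian A the number (A *\<^sub>v x) \<bullet>c x is real, so its real part loses nothing. *)

definition pos_def_mat :: "complex mat \<Rightarrow> bool" where
  "pos_def_mat A \<longleftrightarrow> hermitian_mat A \<and>
     (\<forall>x \<in> carrier_vec (dim_row A). x \<noteq> 0\<^sub>v (dim_row A) \<longrightarrow> Re ((A *\<^sub>v x) \<bullet>c x) > 0)"

definition pos_semidef_mat :: "complex mat \<Rightarrow> bool" where
  "pos_semidef_mat A \<longleftrightarrow> hermitian_mat A \<and>
     (\<forall>x \<in> carrier_vec (dim_row A). Re ((A *\<^sub>v x) \<bullet>c x) \<ge> 0)"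

(* A positive semidefinite A has exactly one positive semidefinite square root;
   for other A the value is unspecified. *)

definition sqrt_mat :: "complex mat \<Rightarrow> complex mat" where
  "sqrt_mat A = (THE S. S \<in> carrier_mat (dim_row A) (dim_row A) \<and> pos_semidef_mat S \<and> S * S = A)"

(* The inverse of an invertible square matrix; unspecified otherwise. *)

definition inv_mat :: "complex mat \<Rightarrow> complex mat" where
  "inv_mat A = the (mat_inverse A)"

definition geometric_mean :: "complex mat \<Rightarrow> complex mat \<Rightarrow> complex mat"  (infixl "\<sharp>" 70) where
  "A \<sharp> B =
     sqrt_mat A * sqrt_mat (inv_mat (sqrt_mat A) * B * inv_mat (sqrt_mat A)) * sqrt_mat A"

definition natural_mean :: "complex mat \<Rightarrow> complex mat \<Rightarrow> complex mat"  (infixl "\<natural>" 70) where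
  "A \<natural> B = sqrt_mat A * sqrt_mat (sqrt_mat B * inv_mat A * sqrt_mat B) * sqrt_mat A"

definition direct_sum_mat :: "complex mat \<Rightarrow> complex mat \<Rightarrow> complex mat"  (infixr "\<oplus>\<^sub>m" 65) where
  "X \<oplus>\<^sub>m Y =
     four_block_mat X (0\<^sub>m (dim_row X) (dim_col Y)) (0\<^sub>m (dim_row Y) (dim_col X)) Y"

(* The square roots of the eigenvalues of X* X, which are real and nonnegative, with
   algebraic multiplicity, in decreasing order. *)

definition singular_values :: "complex mat \<Rightarrow> real list" where
  "singular_values X =
     rev (sorted_list_of_multiset
       (image_mset (\<lambda>z. sqrt (Re z)) (proots (char_poly (mat_adjoint X * X)))))"

(* Singular values are numbered from 1, list positions from 0. *)

definition singular_value :: "nat \<Rightarrow> complex mat \<Rightarrow> real" where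
  "singular_value j X = singular_values X ! (j - 1)"

lemma length_singular_values: "length (singular_values X) = dim_col X"
proof -
  have "mat_adjoint X * X \<in> carrier_mat (dim_col X) (dim_col X)"
    by (auto simp: mat_adjoint_def)
  then have "degree (char_poly (mat_adjoint X * X)) = dim_col X"
    using degree_monic_char_poly by blast
  moreover have "length (sorted_list_of_multiset M) = size M" for M :: "real multiset"
    by (metis mset_sorted_list_of_multiset size_mset)
  ultimately show ?thesis
    by (simp add: singular_values_def size_proots_complex)
qed

end

theory Submission
  imports Defs
begin

text \<open>Put \<open>P = A\<^sup>1\<^sup>/\<^sup>2\<close>, \<open>Q = B\<^sup>1\<^sup>/\<^sup>2\<close> and \<open>X = Q P\<^sup>-\<^sup>1\<close>. Then \<open>A \<sharp> B = P |X| P\<close> and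
  \<open>A \<natural> B = P |X\<^sup>*| P\<close>, while \<open>P X P = P Q\<close>. Since the block matrix with diagonal \<open>|X\<^sup>*|, |X|\<close> and
  off-diagonal \<open>X, X\<^sup>*\<close> is positive semidefinite, so is its congruence by \<open>P \<oplus> P\<close>, whose diagonal
  blocks are the two means and whose off-diagonal block is \<open>P Q\<close>. For a positive semidefinite
  block matrix with diagonal \<open>M, N\<close> and off-diagonal \<open>K\<close>, evaluating the form of \<open>M \<oplus> N\<close>
  on the pairs of left and right singular vectors of \<open>K\<close> and counting dimensions gives
  \<open>s\<^sub>j(K) \<le> s\<^sub>j(M \<oplus> N)\<close>.\<close>

section \<open>Adjoints and the complex inner product\<close>

lemma dim_mat_adjoint [simp]:
  "dim_row (mat_adjoint A) = dim_col A" "dim_col (mat_adjoint A) = dim_row A"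
  by (auto simp: mat_adjoint_def)

lemma mat_adjoint_carrier [simp]:
  "A \<in> carrier_mat m n \<Longrightarrow> mat_adjoint A \<in> carrier_mat n m"
  by (rule carrier_matI) auto

lemma mult_carrier_square_mat [simp]:
  "A \<in> carrier_mat n n \<Longrightarrow> B \<in> carrier_mat n n \<Longrightarrow> A * B \<in> carrier_mat n n"
  by (rule mult_carrier_mat)

lemma mat_adjoint_index [simp]:
  "i < dim_col A \<Longrightarrow> j < dim_row A \<Longrightarrow> mat_adjoint A $$ (i, j) = conjugate (A $$ (j, i))"
  by (simp add: mat_adjoint_def mat_of_rows_def)

lemma mat_adjoint_adjoint [simp]: "mat_adjoint (mat_adjoint A) = A"
  by (rule eq_matI) auto

lemma mat_adjoint_mult:
  fixes A B :: "complex mat"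
  assumes "A \<in> carrier_mat m n" "B \<in> carrier_mat n p"
  shows "mat_adjoint (A * B) = mat_adjoint B * mat_adjoint A"
  using assms
  by (intro eq_matI) (auto simp: scalar_prod_def row_def col_def cnj_sum mult.commute intro!: sum.cong)

lemma mat_adjoint_minus:
  fixes A B :: "complex mat"
  assumes "A \<in> carrier_mat m n" "B \<in> carrier_mat m n"
  shows "mat_adjoint (A - B) = mat_adjoint A - mat_adjoint B"
  using assms by (intro eq_matI) auto

lemma mat_adjoint_mat_diag [simp]:
  "mat_adjoint (mat_diag n f :: complex mat) = mat_diag n (\<lambda>i. cnj (f i))"
  by (rule eq_matI) (auto simp: mat_diag_def)

lemma cscalar_prod_mat_adjoint:
  fixes A :: "complex mat"
  assumes "A \<in> carrier_mat m n" "x \<in> carrier_vec n" "y \<in> carrier_vec m"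
  shows "(A *\<^sub>v x) \<bullet>c y = x \<bullet>c (mat_adjoint A *\<^sub>v y)"
proof -
  have "(A *\<^sub>v x) \<bullet>c y = (\<Sum>i<m. \<Sum>j<n. A $$ (i, j) * x $ j * cnj (y $ i))"
    using assms by (auto simp: scalar_prod_def sum_distrib_right lessThan_atLeast0 intro!: sum.cong)
  also have "\<dots> = (\<Sum>j<n. \<Sum>i<m. A $$ (i, j) * x $ j * cnj (y $ i))"
    by (rule sum.swap)
  also have "\<dots> = x \<bullet>c (mat_adjoint A *\<^sub>v y)"
    using assms by (auto simp: scalar_prod_def cnj_sum sum_distrib_left lessThan_atLeast0 ac_simps intro!: sum.cong)
  finally show ?thesis .
qed

lemma cscalar_prod_swap:
  fixes x y :: "complex vec"
  assumes "x \<in> carrier_vec n" "y \<in> carrier_vec n"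
  shows "y \<bullet>c x = cnj (x \<bullet>c y)"
  using assms by (auto simp: scalar_prod_def cnj_sum mult.commute)

lemma cscalar_prod_self:
  fixes x :: "complex vec"
  shows "x \<bullet>c x = of_real (\<Sum>i<dim_vec x. (cmod (x $ i))\<^sup>2)"
  by (simp add: scalar_prod_def lessThan_atLeast0 flip: complex_norm_square)

lemma Re_cscalar_prod_self_pos:
  fixes x :: "complex vec"
  assumes "x \<in> carrier_vec n" "x \<noteq> 0\<^sub>v n"
  shows "0 < Re (x \<bullet>c x)"
  using conjugate_square_greater_0_vec[of x n] assms by (auto simp: less_complex_def)

section \<open>Unitary matrices and diagonalization of Hermitian matrices\<close>

lemma unitary_right_inverse:
  fixes U :: "complex mat"
  assumes "U \<in> carrier_mat n n" "mat_adjoint U * U = 1\<^sub>m n"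
  shows "U * mat_adjoint U = 1\<^sub>m n"
  using assms mat_mult_left_right_inverse[of "mat_adjoint U" n U] by auto

text \<open>Complete \<open>v\<close> to a basis, orthogonalize and normalize. Gram-Schmidt keeps
  the first vector of its input, so only normalization alters \<open>v\<close>, which accounts for
  the factor \<open>k\<close>.\<close>

lemma unitary_extending_vec:
  fixes v :: "complex vec"
  assumes v: "v \<in> carrier_vec n" and v0: "v \<noteq> 0\<^sub>v n" and n: "0 < n"
  obtains W k where "W \<in> carrier_mat n n" "mat_adjoint W * W = 1\<^sub>m n" "col W 0 = k \<cdot>\<^sub>v v"
proof -
  interpret cof_vec_space n "TYPE(complex)" .
  define ws where "ws = gram_schmidt n (basis_completion v)"
  note b = basis_completion[OF v v0]
  obtain vs where vs: "basis_completion v = v # vs"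
    by (simp add: basis_completion_def Let_def)
  have ws: "corthogonal ws" "set ws \<subseteq> carrier_vec n" "length ws = n"
    using gram_schmidt_result[OF b(2) b(4) b(5) ws_def] b(6) by auto
  have hd: "ws ! 0 = v"
  proof -
    have "ws \<noteq> []"
      using ws(3) n by auto
    then have "ws ! 0 = hd ws"
      by (simp add: hd_conv_nth)
    then show ?thesis
      using gram_schmidt_hd[OF v, of vs] by (simp add: ws_def vs)
  qed
  have wsc: "ws ! i \<in> carrier_vec n" if "i < n" for i
    using ws that by auto
  \<comment> \<open>Gram-Schmidt returns orthogonal vectors that need not have length 1;
    \<open>r i\<close> is the norm of the \<open>i\<close>-th one and becomes the divisor of column
    \<open>i\<close> of \<open>W\<close>.\<close>
  define r where "r i = sqrt (Re (ws ! i \<bullet>c ws ! i))" for i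
  have self: "ws ! i \<bullet>c ws ! i = of_real (r i) * of_real (r i)" and r0: "r i \<noteq> 0" if "i < n" for i
  proof -
    have "ws ! i \<bullet>c ws ! i \<noteq> 0"
      using corthogonalD[OF ws(1), of i i] ws(3) that by auto
    moreover obtain t where t: "ws ! i \<bullet>c ws ! i = of_real t" "0 \<le> t"
      by (rule that[OF cscalar_prod_self]) (simp add: sum_nonneg)
    ultimately show "ws ! i \<bullet>c ws ! i = of_real (r i) * of_real (r i)" "r i \<noteq> 0"
      by (simp_all add: r_def flip: of_real_mult)
  qed
  define W where "W = mat n n (\<lambda>(l, i). ws ! i $ l / of_real (r i))"
  have W: "W \<in> carrier_mat n n"
    by (simp add: W_def)
  have "(mat_adjoint W * W) $$ (i, j) = 1\<^sub>m n $$ (i, j)" if "i < n" "j < n" for i j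
  proof -
    have "(mat_adjoint W * W) $$ (i, j) = (\<Sum>l<n. cnj (ws ! i $ l / of_real (r i)) * (ws ! j $ l / of_real (r j)))"
      using that by (simp add: scalar_prod_def W_def lessThan_atLeast0)
    also have "\<dots> = (\<Sum>l<n. ws ! j $ l * cnj (ws ! i $ l) / (of_real (r i) * of_real (r j)))"
      by (intro sum.cong) simp_all
    also have "\<dots> = (ws ! j \<bullet>c ws ! i) / (of_real (r i) * of_real (r j))"
      using carrier_vecD[OF wsc[OF that(1)]] carrier_vecD[OF wsc[OF that(2)]]
      by (simp add: scalar_prod_def lessThan_atLeast0 sum_divide_distrib)
    finally have "(mat_adjoint W * W) $$ (i, j) = (ws ! j \<bullet>c ws ! i) / (of_real (r i) * of_real (r j))" .
    then show ?thesis
      using corthogonalD[OF ws(1), of j i] ws(3) that self[of i] r0[of i] by auto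
  qed
  then have "mat_adjoint W * W = 1\<^sub>m n"
    using W by (intro eq_matI) auto
  moreover have "col W 0 = (1 / of_real (r 0)) \<cdot>\<^sub>v v"
    using n v by (intro eq_vecI) (auto simp: W_def hd)
  ultimately show thesis
    using that W by blast
qed

text \<open>Deflation: conjugating by a unitary whose first column is an eigenvector for
  \<open>e\<close> splits off a 1 by 1 block, and the induction continues on the Hermitian
  remainder. The order of the factors \<open>es\<close> may be chosen freely and is reproduced on
  the diagonal; this later allows a sorted diagonal.\<close>

theorem hermitian_diagonalization:
  fixes A :: "complex mat"
  assumes "A \<in> carrier_mat n n" "mat_adjoint A = A" "char_poly A = (\<Prod>e\<leftarrow>es. [:- e, 1:])"
  shows "\<exists>U \<in> carrier_mat n n. mat_adjoint U * U = 1\<^sub>m n \<and>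
           mat_adjoint U * A * U = mat_diag n (\<lambda>i. es ! i)"
  using assms
proof (induction es arbitrary: n A)
  case Nil
  then have "n = 0"
    using degree_monic_char_poly[of A n] by auto
  then show ?case
    using Nil by (intro bexI[of _ "1\<^sub>m 0"]) (auto simp: mat_diag_def)
next
  case (Cons e es)
  note A = Cons.prems(1) and herm = Cons.prems(2)
  have "length (e # es) = n"
    using degree_monic_char_poly[OF A] unfolding Cons.prems(3) by (subst (asm) degree_linear_factors) simp
  then obtain m where n: "n = Suc m" and m: "length es = m"
    by auto
  have "eigenvalue A e"
    unfolding eigenvalue_root_char_poly[OF A] Cons.prems(3) by simp
  then obtain v where v: "v \<in> carrier_vec n" "v \<noteq> 0\<^sub>v n" "A *\<^sub>v v = e \<cdot>\<^sub>v v"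
    using A by (auto simp: eigenvalue_def eigenvector_def)
  obtain W k where W: "W \<in> carrier_mat n n" "mat_adjoint W * W = 1\<^sub>m n" "col W 0 = k \<cdot>\<^sub>v v"
    using unitary_extending_vec[OF v(1,2)] n by blast
  note WW = unitary_right_inverse[OF W(1,2)]
  define A' where "A' = mat_adjoint W * A * W"
  have A': "A' \<in> carrier_mat n n" and herm': "mat_adjoint A' = A'"
    using A W(1) herm by (auto simp: A'_def mat_adjoint_mult[of _ n n _ n] assoc_mult_mat[of _ n n _ n _ n])
  \<comment> \<open>Column 0 of \<open>W\<close> is an eigenvector, so \<open>A\<close> scales it by
    \<open>e\<close>; the adjoint of \<open>W\<close> then sends it to the first unit
    vector.\<close>
  have col0: "A' $$ (i, 0) = (if i = 0 then e else 0)" if "i < n" for i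
  proof -
    have W': "mat_adjoint W \<in> carrier_mat n n" and AW: "A * W \<in> carrier_mat n n" and 0: "0 < n"
      using A W(1) n by simp_all
    have "col A' 0 = mat_adjoint W *\<^sub>v (A *\<^sub>v col W 0)"
      unfolding A'_def assoc_mult_mat[OF W' A W(1)] col_mult2[OF W' AW 0] col_mult2[OF A W(1) 0] ..
    also have "\<dots> = e \<cdot>\<^sub>v (mat_adjoint W *\<^sub>v col W 0)"
      using v A W n
      by (simp add: mult_mat_vec[of _ n n] smult_smult_assoc mult.commute)
    also have "mat_adjoint W *\<^sub>v col W 0 = col (mat_adjoint W * W) 0"
      using W(1) n by (simp add: col_mult2[of _ n n _ n])
    finally have "col A' 0 = e \<cdot>\<^sub>v unit_vec n 0"
      using W(2) n by simp
    then have "col A' 0 $ i = (e \<cdot>\<^sub>v unit_vec n 0) $ i"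
      by simp
    then show ?thesis
      using A' n that by simp
  qed
  \<comment> \<open>Hermitian symmetry carries the zeros of column 0 over to row 0.\<close>
  have row0: "A' $$ (0, i) = (if i = 0 then e else 0)" if "i < n" for i
  proof -
    have "A' $$ (0, i) = cnj (A' $$ (i, 0))"
      using mat_adjoint_index[of 0 A' i] A' n that herm' by simp
    then show ?thesis
      using col0[OF that] col0[of 0] mat_adjoint_index[of 0 A' 0] A' n herm' by auto
  qed
  define A1 where "A1 = mat 1 1 (\<lambda>_. e)"
  define A3 where "A3 = mat m m (\<lambda>(i, j). A' $$ (Suc i, Suc j))"
  have A1: "A1 \<in> carrier_mat 1 1" and A3: "A3 \<in> carrier_mat m m"
    by (auto simp: A1_def A3_def)
  have A'_block: "A' = four_block_mat A1 (0\<^sub>m 1 m) (0\<^sub>m m 1) A3"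
    using A' n by (intro eq_matI) (auto simp: A1_def A3_def col0 row0)
  have herm3: "mat_adjoint A3 = A3"
  proof (rule eq_matI)
    fix i j assume "i < dim_row A3" "j < dim_col A3"
    then show "mat_adjoint A3 $$ (i, j) = A3 $$ (i, j)"
      using mat_adjoint_index[of "Suc i" A' "Suc j"] herm' A' n by (auto simp: A3_def)
  qed (auto simp: A3_def)
  have "similar_mat_wit A' A (mat_adjoint W) W"
    by (rule similar_mat_witI[of _ _ n]) (use A' A W WW in \<open>auto simp: A'_def\<close>)
  then have "char_poly A' = char_poly A"
    by (intro char_poly_similar) (auto simp: similar_mat_def)
  moreover have "char_poly A' = char_poly A1 * char_poly A3"
    unfolding A'_block by (rule char_poly_four_block_zeros_col[OF A1 _ A3]) simp
  moreover have "char_poly A1 = [:- e, 1:]"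
    by (simp add: A1_def char_poly_defs det_def sign_def)
  \<comment> \<open>Cancelling the linear factor of \<open>e\<close> leaves exactly the
    factorization over the tail \<open>es\<close> that the induction hypothesis asks for.\<close>
  ultimately have "[:- e, 1:] * char_poly A3 = [:- e, 1:] * (\<Prod>e\<leftarrow>es. [:- e, 1:])"
    using Cons.prems(3) by simp
  then have "char_poly A3 = (\<Prod>e\<leftarrow>es. [:- e, 1:])"
    by (subst (asm) mult_left_cancel) auto
  from Cons.IH[OF A3 herm3 this] obtain P where P: "P \<in> carrier_mat m m"
    "mat_adjoint P * P = 1\<^sub>m m" "mat_adjoint P * A3 * P = mat_diag m (\<lambda>i. es ! i)"
    by blast
  \<comment> \<open>Bordering \<open>P\<close> by a 1 leaves the split-off block alone, so
    \<open>W * F\<close> diagonalizes \<open>A\<close>.\<close>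
  define F where "F = four_block_mat (1\<^sub>m 1) (0\<^sub>m 1 m) (0\<^sub>m m 1) P"
  have F: "F \<in> carrier_mat n n"
    using P(1) n by (auto simp: F_def)
  have adjF: "mat_adjoint F = four_block_mat (1\<^sub>m 1) (0\<^sub>m 1 m) (0\<^sub>m m 1) (mat_adjoint P)"
    using P(1) by (intro eq_matI) (auto simp: F_def)
  have adjP: "mat_adjoint P \<in> carrier_mat m m"
    using P(1) by simp
  have block_mult: "four_block_mat X (0\<^sub>m 1 m) (0\<^sub>m m 1) Y * four_block_mat X' (0\<^sub>m 1 m) (0\<^sub>m m 1) Y'
      = four_block_mat (X * X') (0\<^sub>m 1 m) (0\<^sub>m m 1) (Y * Y')"
    if "X \<in> carrier_mat 1 1" "Y \<in> carrier_mat m m" "X' \<in> carrier_mat 1 1" "Y' \<in> carrier_mat m m"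
    for X Y X' Y' :: "complex mat"
    using that by (subst mult_four_block_mat[of _ 1 1 _ m _ m _ _ 1 _ m]) auto
  have FF: "mat_adjoint F * F = 1\<^sub>m n"
    unfolding adjF unfolding F_def using P(1,2) adjP
    by (subst block_mult) (auto simp: n)
  have "mat_adjoint F * A' = four_block_mat A1 (0\<^sub>m 1 m) (0\<^sub>m m 1) (mat_adjoint P * A3)"
    unfolding adjF A'_block using adjP A1 A3 by (subst block_mult) auto
  then have "mat_adjoint F * A' * F = four_block_mat A1 (0\<^sub>m 1 m) (0\<^sub>m m 1) (mat_adjoint P * A3) * F"
    by simp
  also have "\<dots> = four_block_mat A1 (0\<^sub>m 1 m) (0\<^sub>m m 1) (mat_adjoint P * A3 * P)"
    unfolding F_def using P(1) adjP A1 A3 by (subst block_mult) auto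
  also have "\<dots> = mat_diag n (\<lambda>i. (e # es) ! i)"
    unfolding P(3) by (intro eq_matI) (auto simp: n A1_def mat_diag_def nth_Cons')
  finally have FAF: "mat_adjoint F * A' * F = mat_diag n (\<lambda>i. (e # es) ! i)" .
  note assoc = assoc_mult_mat[of _ n n _ n _ n]
  have adjWF: "mat_adjoint (W * F) = mat_adjoint F * mat_adjoint W"
    using W(1) F by (rule mat_adjoint_mult)
  have "mat_adjoint (W * F) * A * (W * F) = mat_diag n (\<lambda>i. (e # es) ! i)"
    unfolding FAF[symmetric] adjWF A'_def using W(1) F A by (simp add: assoc)
  moreover have "mat_adjoint (W * F) * (W * F) = mat_adjoint F * (mat_adjoint W * W) * F"
    unfolding adjWF using W(1) F by (simp add: assoc)
  then have "mat_adjoint (W * F) * (W * F) = 1\<^sub>m n"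
    using W(2) F FF by simp
  moreover have "W * F \<in> carrier_mat n n"
    using W(1) F by simp
  ultimately show ?case
    by blast
qed

section \<open>Quadratic forms and positive semidefinite matrices\<close>

lemma cscalar_prod_smult_left:
  fixes x y :: "complex vec"
  shows "dim_vec x = dim_vec y \<Longrightarrow> (a \<cdot>\<^sub>v x) \<bullet>c y = a * (x \<bullet>c y)"
  by (simp add: scalar_prod_def sum_distrib_left mult.assoc)

lemma cscalar_prod_smult_right:
  fixes x y :: "complex vec"
  shows "dim_vec x = dim_vec y \<Longrightarrow> x \<bullet>c (a \<cdot>\<^sub>v y) = cnj a * (x \<bullet>c y)"
  by (simp add: scalar_prod_def sum_distrib_left ac_simps)

lemma cscalar_prod_add_left:
  fixes x y z :: "complex vec"
  shows "dim_vec x = dim_vec z \<Longrightarrow> dim_vec y = dim_vec z \<Longrightarrow> (x + y) \<bullet>c z = x \<bullet>c z + y \<bullet>c z"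
  by (simp add: scalar_prod_def sum.distrib distrib_right)

lemma cscalar_prod_add_right:
  fixes x y z :: "complex vec"
  shows "dim_vec x = dim_vec z \<Longrightarrow> dim_vec y = dim_vec z \<Longrightarrow> z \<bullet>c (x + y) = z \<bullet>c x + z \<bullet>c y"
  by (simp add: scalar_prod_def sum.distrib distrib_left)

lemma cscalar_prod_minus_left:
  fixes x y z :: "complex vec"
  shows "dim_vec x = dim_vec z \<Longrightarrow> dim_vec y = dim_vec z \<Longrightarrow> (x - y) \<bullet>c z = x \<bullet>c z - y \<bullet>c z"
  by (simp add: scalar_prod_def sum_subtractf left_diff_distrib)

lemma cscalar_prod_minus_right:
  fixes x y z :: "complex vec"
  shows "dim_vec x = dim_vec z \<Longrightarrow> dim_vec y = dim_vec z \<Longrightarrow> z \<bullet>c (x - y) = z \<bullet>c x - z \<bullet>c y"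
  by (simp add: scalar_prod_def sum_subtractf right_diff_distrib)

lemmas cscalar_prod_simps =
  cscalar_prod_smult_left cscalar_prod_smult_right cscalar_prod_add_left cscalar_prod_add_right
  cscalar_prod_minus_left cscalar_prod_minus_right

lemma mat_diag_mult_vec_index:
  fixes x :: "complex vec"
  assumes "x \<in> carrier_vec n" "i < n"
  shows "(mat_diag n f *\<^sub>v x) $ i = f i * x $ i"
proof -
  have "(mat_diag n f *\<^sub>v x) $ i = (\<Sum>k<n. (if i = k then f k else 0) * x $ k)"
    using assms by (simp add: mat_diag_def scalar_prod_def lessThan_atLeast0)
  also have "\<dots> = (\<Sum>k<n. if k = i then f i * x $ i else 0)"
    by (intro sum.cong) auto
  finally show ?thesis
    using assms by simp
qed

lemma cscalar_prod_mat_diag: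
  fixes x y :: "complex vec"
  assumes "x \<in> carrier_vec n" "y \<in> carrier_vec n"
  shows "(mat_diag n f *\<^sub>v x) \<bullet>c y = (\<Sum>i<n. f i * (x $ i * cnj (y $ i)))"
  using assms
  by (auto simp: mat_diag_mult_vec_index scalar_prod_def lessThan_atLeast0 ac_simps intro!: sum.cong)

lemma cscalar_prod_congruence:
  fixes A U :: "complex mat"
  assumes "A \<in> carrier_mat m m" "U \<in> carrier_mat m n" "x \<in> carrier_vec n" "y \<in> carrier_vec n"
  shows "((mat_adjoint U * A * U) *\<^sub>v x) \<bullet>c y = (A *\<^sub>v (U *\<^sub>v x)) \<bullet>c (U *\<^sub>v y)"
proof -
  have "mat_adjoint U \<in> carrier_mat n m" "U *\<^sub>v x \<in> carrier_vec m"
    "mat_adjoint U * A \<in> carrier_mat n m" "A *\<^sub>v (U *\<^sub>v x) \<in> carrier_vec m"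
    using assms by auto
  then show ?thesis
    using assms cscalar_prod_mat_adjoint[of "mat_adjoint U" n m "A *\<^sub>v (U *\<^sub>v x)" y]
    by (simp add: assoc_mult_mat_vec[of _ n m _ n] assoc_mult_mat_vec[of _ n m _ m])
qed

lemma pos_semidef_mat_iff:
  "A \<in> carrier_mat n n \<Longrightarrow> pos_semidef_mat A \<longleftrightarrow>
     mat_adjoint A = A \<and> (\<forall>x \<in> carrier_vec n. 0 \<le> Re ((A *\<^sub>v x) \<bullet>c x))"
  by (auto simp: pos_semidef_mat_def hermitian_mat_def)

lemma pos_def_imp_pos_semidef:
  assumes "pos_def_mat A"
  shows "pos_semidef_mat A"
  unfolding pos_semidef_mat_def
proof (intro conjI ballI)
  fix x :: "complex vec" assume "x \<in> carrier_vec (dim_row A)"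
  moreover have "(A *\<^sub>v 0\<^sub>v (dim_row A)) \<bullet>c 0\<^sub>v (dim_row A) = 0"
    by (simp add: scalar_prod_def)
  ultimately show "0 \<le> Re ((A *\<^sub>v x) \<bullet>c x)"
    using assms unfolding pos_def_mat_def by (cases "x = 0\<^sub>v (dim_row A)") (auto intro: less_imp_le)
qed (use assms in \<open>simp add: pos_def_mat_def\<close>)

text \<open>Moving the Hermitian matrix to the other side shows that the value equals its own
  conjugate. The real witness allows later identities between complex numbers to be read as real
  ones.\<close>

lemma pos_semidef_form:
  assumes "A \<in> carrier_mat n n" "pos_semidef_mat A" "x \<in> carrier_vec n"
  obtains a where "(A *\<^sub>v x) \<bullet>c x = of_real a" "0 \<le> a"
proof
  have "(A *\<^sub>v x) \<bullet>c x = x \<bullet>c (A *\<^sub>v x)"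
    using assms cscalar_prod_mat_adjoint[of A n n x x] by (simp add: pos_semidef_mat_iff)
  also have "\<dots> = cnj ((A *\<^sub>v x) \<bullet>c x)"
    using assms by (intro cscalar_prod_swap[of _ n]) auto
  finally show "(A *\<^sub>v x) \<bullet>c x = of_real (Re ((A *\<^sub>v x) \<bullet>c x))"
    by (simp add: complex_eq_iff)
  show "0 \<le> Re ((A *\<^sub>v x) \<bullet>c x)"
    using assms by (simp add: pos_semidef_mat_iff)
qed

text \<open>The form of the new matrix at \<open>x\<close> is the form of \<open>A\<close> at
  \<open>U *\<^sub>v x\<close>. Gram matrices, square roots and inverses all get their positivity
  from this.\<close>

lemma pos_semidef_congruence:
  assumes "A \<in> carrier_mat m m" "pos_semidef_mat A" "U \<in> carrier_mat m n"
  shows "pos_semidef_mat (mat_adjoint U * A * U)"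
proof -
  have U: "mat_adjoint U \<in> carrier_mat n m"
    using assms by simp
  have UA: "mat_adjoint U * A \<in> carrier_mat n m"
    using U assms by auto
  have c: "mat_adjoint U * A * U \<in> carrier_mat n n"
    using UA assms by auto
  have "mat_adjoint (mat_adjoint U * A * U) = mat_adjoint U * (mat_adjoint A * U)"
    using assms by (simp add: mat_adjoint_mult[OF UA assms(3)] mat_adjoint_mult[OF U assms(1)])
  also have "\<dots> = mat_adjoint U * A * U"
    using assms by (simp add: assoc_mult_mat[OF U assms(1,3)] pos_semidef_mat_iff)
  finally show ?thesis
    using assms by (auto simp: pos_semidef_mat_iff[OF c] cscalar_prod_congruence pos_semidef_mat_iff[OF assms(1)])
qed

lemma pos_semidef_one: "pos_semidef_mat (1\<^sub>m n)"
proof -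
  have "mat_adjoint (1\<^sub>m n :: complex mat) = 1\<^sub>m n"
    by (rule eq_matI) auto
  moreover have "0 \<le> Re ((1\<^sub>m n *\<^sub>v x) \<bullet>c x)" if "x \<in> carrier_vec n" for x
    using that by (simp add: cscalar_prod_self sum_nonneg flip: of_real_sum)
  ultimately show ?thesis
    by (simp add: pos_semidef_mat_iff[of _ n])
qed

lemma pos_semidef_gram:
  assumes "X \<in> carrier_mat m n"
  shows "pos_semidef_mat (mat_adjoint X * X)"
proof -
  have "mat_adjoint X \<in> carrier_mat n m"
    using assms by simp
  then show ?thesis
    using pos_semidef_congruence[OF one_carrier_mat pos_semidef_one assms] right_mult_one_mat by metis
qed

lemma unitary_conjugation_cancel:
  fixes A U :: "complex mat"
  assumes "A \<in> carrier_mat n n" "U \<in> carrier_mat n n" "mat_adjoint U * U = 1\<^sub>m n"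
    and D: "mat_adjoint U * A * U = D"
  shows "A = U * D * mat_adjoint U"
proof -
  have U: "mat_adjoint U \<in> carrier_mat n n"
    using assms by simp
  have "U * D * mat_adjoint U = (U * mat_adjoint U) * A * (U * mat_adjoint U)"
    unfolding D[symmetric] using assms(1,2) U by (simp add: assoc_mult_mat[of _ n n _ n _ n])
  then show ?thesis
    using assms(1) unitary_right_inverse[OF assms(2,3)] by simp
qed

lemma hermitian_diagonalizable:
  fixes A :: "complex mat"
  assumes "A \<in> carrier_mat n n" "mat_adjoint A = A"
  obtains U f where "U \<in> carrier_mat n n" "mat_adjoint U * U = 1\<^sub>m n"
    "mat_adjoint U * A * U = mat_diag n f"
proof -
  obtain es where "char_poly A = (\<Prod>e\<leftarrow>es. [:- e, 1:])"
    using char_poly_factorized[OF assms(1)] by blast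
  then show thesis
    using hermitian_diagonalization[OF assms] that by blast
qed

text \<open>The entry \<open>f i\<close> is the value of the form of \<open>A\<close> at column
  \<open>i\<close> of \<open>U\<close>.\<close>

lemma pos_semidef_diagonal_entry:
  assumes "A \<in> carrier_mat n n" "pos_semidef_mat A" "U \<in> carrier_mat n n"
    and D: "mat_adjoint U * A * U = mat_diag n f" and i: "i < n"
  shows "f i = of_real (Re (f i))" "0 \<le> Re (f i)"
proof -
  let ?e = "unit_vec n i :: complex vec"
  have "(mat_diag n f *\<^sub>v ?e) \<bullet>c ?e = (\<Sum>k<n. if k = i then f i else 0)"
    unfolding cscalar_prod_mat_diag[OF unit_vec_carrier unit_vec_carrier]
    using i by (intro sum.cong) auto
  then have "f i = (A *\<^sub>v (U *\<^sub>v ?e)) \<bullet>c (U *\<^sub>v ?e)"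
    using i assms cscalar_prod_congruence[OF assms(1,3), of ?e ?e] by simp
  moreover obtain a where "(A *\<^sub>v (U *\<^sub>v ?e)) \<bullet>c (U *\<^sub>v ?e) = of_real a" "0 \<le> a"
    by (rule pos_semidef_form[OF assms(1,2), of "U *\<^sub>v ?e"]) (use assms(3) in auto)
  ultimately show "f i = of_real (Re (f i))" "0 \<le> Re (f i)"
    by simp_all
qed

lemma pos_semidef_mat_diag:
  assumes "\<And>i. i < n \<Longrightarrow> 0 \<le> d i"
  shows "pos_semidef_mat (mat_diag n (\<lambda>i. of_real (d i)))"
proof -
  have "0 \<le> Re ((mat_diag n (\<lambda>i. of_real (d i)) *\<^sub>v x) \<bullet>c x)" if "x \<in> carrier_vec n" for x
  proof -
    have "(mat_diag n (\<lambda>i. of_real (d i)) *\<^sub>v x) \<bullet>c x = of_real (\<Sum>i<n. d i * (cmod (x $ i))\<^sup>2)"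
      unfolding cscalar_prod_mat_diag[OF that that] complex_norm_square[symmetric] by simp
    then show ?thesis
      using assms by (auto intro!: sum_nonneg)
  qed
  then show ?thesis
    by (simp add: pos_semidef_mat_iff[OF mat_diag_dim])
qed

section \<open>Existence and uniqueness of the positive semidefinite square root\<close>

lemma pos_semidef_sqrt_exists:
  assumes A: "A \<in> carrier_mat n n" "pos_semidef_mat A"
  obtains S where "S \<in> carrier_mat n n" "pos_semidef_mat S" "S * S = A"
proof -
  have "mat_adjoint A = A"
    using A by (simp add: pos_semidef_mat_iff)
  then obtain U f where U: "U \<in> carrier_mat n n" "mat_adjoint U * U = 1\<^sub>m n"
    "mat_adjoint U * A * U = mat_diag n f"
    using hermitian_diagonalizable[OF A(1)] by blast
  define d where "d i = sqrt (Re (f i))" for i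
  define D where "D = mat_diag n (\<lambda>i. of_real (d i) :: complex)"
  note f = pos_semidef_diagonal_entry[OF A U(1,3)]
  have D: "D \<in> carrier_mat n n" "pos_semidef_mat D"
    unfolding D_def by (auto intro!: pos_semidef_mat_diag simp: d_def f(2))
  have "D * D = mat_diag n f"
    unfolding D_def mat_diag_diag
  proof (rule eq_matI)
    fix i j assume "i < dim_row (mat_diag n f)" "j < dim_col (mat_diag n f)"
    then show "mat_diag n (\<lambda>i. of_real (d i) * of_real (d i)) $$ (i, j) = mat_diag n f $$ (i, j)"
      using f(1)[of j, symmetric] f(2)[of j] by (auto simp: mat_diag_def d_def simp flip: of_real_mult)
  qed (auto simp: mat_diag_def)
  have U': "mat_adjoint U \<in> carrier_mat n n"
    using U by simp
  show thesis
  proof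
    show "U * D * mat_adjoint U \<in> carrier_mat n n"
      using U(1) D U' by simp
    show "pos_semidef_mat (U * D * mat_adjoint U)"
      using pos_semidef_congruence[OF D U'] by simp
    have "U * D * mat_adjoint U * (U * D * mat_adjoint U) = U * (D * (mat_adjoint U * U) * D) * mat_adjoint U"
      using U(1) U' D(1) by (simp add: assoc_mult_mat[of _ n n _ n _ n])
    also have "\<dots> = U * (D * D) * mat_adjoint U"
      using D U(2) by simp
    also have "\<dots> = A"
      unfolding \<open>D * D = mat_diag n f\<close> using unitary_conjugation_cancel[OF A(1) U] by simp
    finally show "U * D * mat_adjoint U * (U * D * mat_adjoint U) = A" .
  qed
qed

text \<open>Diagonalize the Hermitian difference \<open>E = S - T\<close>. At a unit eigenvector
  \<open>u\<close> with eigenvalue \<open>f i\<close>, let \<open>a\<close> and \<open>b\<close> be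
  the values of the forms of \<open>S\<close> and \<open>T\<close>; then \<open>f i = a - b\<close>.
  Equal squares give \<open>S u\<close> and \<open>T u\<close> the same length, which becomes
  \<open>(a - b) * (a + b) = 0\<close>. As \<open>a\<close> and \<open>b\<close> are nonnegative,
  \<open>a = b\<close>, so every eigenvalue of \<open>E\<close> is 0.\<close>

lemma pos_semidef_sqrt_unique:
  assumes S: "S \<in> carrier_mat n n" "pos_semidef_mat S"
    and T: "T \<in> carrier_mat n n" "pos_semidef_mat T"
    and eq: "S * S = T * T"
  shows "S = T"
proof -
  define E where "E = S - T"
  have SE: "S = T + E"
    using S(1) T(1) unfolding E_def by (intro eq_matI) auto
  have adjS: "mat_adjoint S = S" and adjT: "mat_adjoint T = T"
    using S T by (simp_all add: pos_semidef_mat_iff)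
  have E: "E \<in> carrier_mat n n" "mat_adjoint E = E"
    using minus_carrier_mat[OF T(1)] mat_adjoint_minus[OF S(1) T(1)] by (simp_all add: E_def adjS adjT)
  obtain U f where U: "U \<in> carrier_mat n n" "mat_adjoint U * U = 1\<^sub>m n"
    "mat_adjoint U * E * U = mat_diag n f"
    by (rule hermitian_diagonalizable[OF E])
  have f0: "f i = 0" if i: "i < n" for i
  proof -
    define e :: "complex vec" where "e = unit_vec n i"
    define u where "u = U *\<^sub>v e"
    have e: "e \<in> carrier_vec n" and u: "u \<in> carrier_vec n"
      using U(1) by (auto simp: e_def u_def)
    have "mat_adjoint U *\<^sub>v u = (mat_adjoint U * U) *\<^sub>v e"
      unfolding u_def using U(1) e by (intro assoc_mult_mat_vec[symmetric, of _ n n _ n]) auto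
    then have uu: "u \<bullet>c u = 1"
      using cscalar_prod_mat_adjoint[OF U(1) e u] i U(2) e unfolding u_def[symmetric] by (simp add: e_def)
    \<comment> \<open>Read columnwise, this says that the columns of \<open>U\<close> are
      eigenvectors of \<open>E\<close>.\<close>
    have "E * U = U * mat_diag n f"
    proof -
      have "U * mat_diag n f = (U * mat_adjoint U) * (E * U)"
        unfolding U(3)[symmetric] using U(1) E(1) by (simp add: assoc_mult_mat[of _ n n _ n _ n])
      then show ?thesis
        using unitary_right_inverse[OF U(1,2)] E(1) U(1) by simp
    qed
    moreover have "mat_diag n f *\<^sub>v e = f i \<cdot>\<^sub>v e"
      using i by (intro eq_vecI) (auto simp: e_def mat_diag_def)
    ultimately have "(E * U) *\<^sub>v e = U *\<^sub>v (f i \<cdot>\<^sub>v e)"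
      using U(1) e by (simp add: assoc_mult_mat_vec[OF U(1) mat_diag_dim e])
    then have Eu: "E *\<^sub>v u = f i \<cdot>\<^sub>v u"
      unfolding u_def assoc_mult_mat_vec[OF E(1) U(1) e] mult_mat_vec[OF U(1) e] .
    have Su: "S *\<^sub>v u = T *\<^sub>v u + f i \<cdot>\<^sub>v u"
      unfolding SE Eu[symmetric] using T(1) E(1) u by (rule add_mult_distrib_mat_vec)
    obtain a where a: "(S *\<^sub>v u) \<bullet>c u = of_real a" "0 \<le> a"
      by (rule pos_semidef_form[OF S u])
    obtain b where b: "(T *\<^sub>v u) \<bullet>c u = of_real b" "0 \<le> b"
      by (rule pos_semidef_form[OF T u])
    have dims: "dim_vec u = n" "dim_row T = n" "dim_row S = n"
      using u T(1) S(1) by auto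
    have f: "f i = of_real (a - b)"
      using a(1) b(1) uu by (simp add: Su cscalar_prod_simps dims algebra_simps)
    have b': "u \<bullet>c (T *\<^sub>v u) = of_real b"
      using cscalar_prod_mat_adjoint[OF T(1) u u] adjT b(1) by simp
    have "(S *\<^sub>v u) \<bullet>c (S *\<^sub>v u) = ((S * S) *\<^sub>v u) \<bullet>c u"
      using S(1) u cscalar_prod_mat_adjoint[of S n n "S *\<^sub>v u" u] by (simp add: adjS)
    also have "\<dots> = (T *\<^sub>v u) \<bullet>c (T *\<^sub>v u)"
      unfolding eq using T(1) u cscalar_prod_mat_adjoint[of T n n "T *\<^sub>v u" u] by (simp add: adjT)
    finally have "of_real (2 * (a - b) * b + (a - b) * (a - b)) = (0 :: complex)"
      using uu b b' by (simp add: Su cscalar_prod_simps dims f algebra_simps)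
    then have "(a - b) * (a + b) = 0"
      unfolding of_real_eq_0_iff by (simp add: algebra_simps)
    then have "a = b"
      using a(2) b(2) by auto
    then show ?thesis
      using f by simp
  qed
  have "mat_diag n f = 0\<^sub>m n n"
    by (intro eq_matI) (auto simp: mat_diag_def f0)
  then have "E = 0\<^sub>m n n"
    using unitary_conjugation_cancel[OF E(1) U] U(1) by simp
  then show ?thesis
    using SE T(1) by simp
qed

text \<open>Uniqueness makes the definite description denote. A root is then computed by exhibiting
  any positive semidefinite matrix with the right square.\<close>

lemma sqrt_mat_eqI:
  assumes "S \<in> carrier_mat n n" "pos_semidef_mat S" "S * S = A"
  shows "sqrt_mat A = S"
  unfolding sqrt_mat_def
proof (rule the_equality)
  have "dim_row A = n"
    using assms by auto
  then show "S \<in> carrier_mat (dim_row A) (dim_row A) \<and> pos_semidef_mat S \<and> S * S = A"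
    using assms by simp
  show "T = S" if T: "T \<in> carrier_mat (dim_row A) (dim_row A) \<and> pos_semidef_mat T \<and> T * T = A" for T
    by (rule pos_semidef_sqrt_unique[OF _ _ assms(1,2)]) (use T assms(3) \<open>dim_row A = n\<close> in simp_all)
qed

lemma sqrt_mat:
  assumes "A \<in> carrier_mat n n" "pos_semidef_mat A"
  shows "sqrt_mat A \<in> carrier_mat n n" "pos_semidef_mat (sqrt_mat A)"
    "sqrt_mat A * sqrt_mat A = A"
proof -
  obtain S where S: "S \<in> carrier_mat n n" "pos_semidef_mat S" "S * S = A"
    by (rule pos_semidef_sqrt_exists[OF assms])
  show "sqrt_mat A \<in> carrier_mat n n" "pos_semidef_mat (sqrt_mat A)"
    "sqrt_mat A * sqrt_mat A = A"
    unfolding sqrt_mat_eqI[OF S] by (fact S)+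
qed

lemma mat_adjoint_sqrt_mat:
  assumes "A \<in> carrier_mat n n" "pos_semidef_mat A"
  shows "mat_adjoint (sqrt_mat A) = sqrt_mat A"
  using sqrt_mat[OF assms] by (simp add: pos_semidef_mat_iff)

section \<open>Inverses and nonsingularity\<close>

lemma inv_mat:
  assumes A: "A \<in> carrier_mat n n" and "det A \<noteq> 0"
  shows "inv_mat A \<in> carrier_mat n n" "A * inv_mat A = 1\<^sub>m n" "inv_mat A * A = 1\<^sub>m n"
proof -
  obtain B where "mat_inverse A = Some B"
    using mat_inverse(1)[OF A, of n] det_non_zero_imp_unit[OF assms, of n] by (cases "mat_inverse A") auto
  then show "inv_mat A \<in> carrier_mat n n" "A * inv_mat A = 1\<^sub>m n" "inv_mat A * A = 1\<^sub>m n"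
    using mat_inverse(2)[OF A] by (auto simp: inv_mat_def)
qed

lemma inv_mat_eqI:
  assumes A: "A \<in> carrier_mat n n" and B: "B \<in> carrier_mat n n" and AB: "A * B = 1\<^sub>m n"
  shows "inv_mat A = B"
proof -
  have "det A * det B = 1"
    using det_mult[OF A B] AB by simp
  then have "det A \<noteq> 0"
    by auto
  note i = inv_mat[OF A this]
  have "inv_mat A = inv_mat A * (A * B)"
    using AB i by simp
  also have "\<dots> = (inv_mat A * A) * B"
    using A B i(1) by (simp add: assoc_mult_mat[of _ n n _ n _ n])
  finally show ?thesis
    using B i(3) by simp
qed

lemma mat_adjoint_inv_mat:
  assumes A: "A \<in> carrier_mat n n" and d: "det A \<noteq> 0" and "mat_adjoint A = A"
  shows "mat_adjoint (inv_mat A) = inv_mat A"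
proof -
  note i = inv_mat[OF A d]
  have "A * mat_adjoint (inv_mat A) = mat_adjoint (inv_mat A * A)"
    using assms i(1) by (simp add: mat_adjoint_mult[of _ n n _ n])
  also have "\<dots> = 1\<^sub>m n"
    unfolding i(3) by (intro eq_matI) auto
  finally show ?thesis
    using inv_mat_eqI[OF A _, of "mat_adjoint (inv_mat A)"] i(1) by simp
qed

lemma pos_def_det_nonzero:
  assumes A: "A \<in> carrier_mat n n" and "pos_def_mat A"
  shows "det A \<noteq> 0"
proof
  assume "det A = 0"
  then obtain v where v: "v \<in> carrier_vec n" "v \<noteq> 0\<^sub>v n" "A *\<^sub>v v = 0\<^sub>v n"
    using det_0_iff_vec_prod_zero_field[OF A] by auto
  then have "0 < Re ((A *\<^sub>v v) \<bullet>c v)"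
    using assms by (auto simp: pos_def_mat_def)
  then show False
    using v by simp
qed

lemma det_sqrt_mat_nonzero:
  assumes "A \<in> carrier_mat n n" "pos_semidef_mat A" "det A \<noteq> 0"
  shows "det (sqrt_mat A) \<noteq> 0"
proof -
  note S = sqrt_mat[OF assms(1,2)]
  show ?thesis
    using det_mult[OF S(1,1)] assms(3) S(3) by auto
qed

text \<open>The inverse is itself a congruence of \<open>A\<close>: it equals its adjoint times
  \<open>A\<close> times itself.\<close>

lemma pos_semidef_inv_mat:
  assumes A: "A \<in> carrier_mat n n" "pos_semidef_mat A" and d: "det A \<noteq> 0"
  shows "pos_semidef_mat (inv_mat A)"
proof -
  note i = inv_mat[OF A(1) d]
  have adj: "mat_adjoint (inv_mat A) = inv_mat A"
    using mat_adjoint_inv_mat[OF A(1) d] A by (simp add: pos_semidef_mat_iff)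
  have "mat_adjoint (inv_mat A) * A * inv_mat A = inv_mat A"
    unfolding adj i(3) using i(1) by simp
  then show ?thesis
    using pos_semidef_congruence[OF A i(1)] by simp
qed

section \<open>Singular values and their comparison by test vectors\<close>

text \<open>Listing the eigenvalues of \<open>X\<^sup>* X\<close> in the order of \<^const>\<open>singular_values\<close>
  makes the diagonalization of \<open>X\<^sup>* X\<close> a singular value decomposition with sorted diagonal.\<close>

lemma singular_value_decomposition:
  assumes X: "X \<in> carrier_mat m n"
  shows "\<exists>U \<in> carrier_mat n n. mat_adjoint U * U = 1\<^sub>m n \<and>
    mat_adjoint (X * U) * (X * U) = mat_diag n (\<lambda>i. of_real ((singular_values X ! i)\<^sup>2)) \<and>
    (\<forall>i < n. 0 \<le> singular_values X ! i)"
proof -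
  define G where "G = mat_adjoint X * X"
  define h where "h = (\<lambda>z. sqrt (Re z))"
  have X': "mat_adjoint X \<in> carrier_mat n m"
    using X by simp
  have G: "G \<in> carrier_mat n n" "pos_semidef_mat G" "mat_adjoint G = G"
    using X pos_semidef_gram[OF X] by (auto simp: G_def mat_adjoint_mult[OF X' X])
  obtain as where as: "char_poly G = (\<Prod>a\<leftarrow>as. [:- a, 1:])"
    using char_poly_factorized[OF G(1)] by blast
  have "proots (\<Prod>a\<leftarrow>as. [:- a, 1:]) = mset as" for as :: "complex list"
  proof (induction as)
    case (Cons a as)
    have "(\<Prod>a\<leftarrow>as. [:- a, 1:]) \<noteq> 0"
      by (auto simp: prod_list_zero_iff)
    then show ?case
      using Cons by (simp add: proots_mult del: mult_pCons_left)
  qed simp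
  then have mset: "proots (char_poly G) = mset as"
    by (simp add: as)
  \<comment> \<open>The key \<open>h\<close> takes an eigenvalue of \<open>G\<close> to the
    corresponding singular value, so the reversed sort lists the eigenvalues in the order of
    \<open>singular_values\<close>.\<close>
  define es where "es = rev (sort_key h as)"
  have "sorted (map h (sort_key h as))"
    by simp
  moreover have "mset (map h (sort_key h as)) = image_mset h (proots (char_poly G))"
    by (simp add: mset)
  ultimately have "sorted_list_of_multiset (image_mset h (proots (char_poly G))) = map h (sort_key h as)"
    by (metis sorted_list_of_multiset_mset sorted_sort_id)
  then have sv: "singular_values X = map h es"
    unfolding singular_values_def es_def h_def G_def by (simp add: rev_map)
  have len: "length es = n"
    using length_singular_values[of X] X by (simp add: sv)
  \<comment> \<open>Reordering the factors leaves the characteristic polynomial unchanged, so the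
    diagonalization may be taken in the sorted order.\<close>
  have "(\<Prod>e\<leftarrow>es. [:- e, 1:]) = (\<Prod>a\<leftarrow>as. [:- a, 1:])"
    unfolding prod_mset_prod_list[symmetric] by (simp add: es_def)
  then obtain U where U: "U \<in> carrier_mat n n" "mat_adjoint U * U = 1\<^sub>m n"
    "mat_adjoint U * G * U = mat_diag n (\<lambda>i. es ! i)"
    using hermitian_diagonalization[OF G(1,3), of es] as by auto
  note e = pos_semidef_diagonal_entry[OF G(1,2) U(1,3)]
  \<comment> \<open>Since \<open>es ! i\<close> is real and nonnegative, neither \<open>Re\<close>
    nor the square root loses anything.\<close>
  have "of_real ((singular_values X ! i)\<^sup>2) = es ! i" if "i < n" for i
    using that len e(1)[OF that, symmetric] e(2)[OF that] by (simp add: sv h_def flip: of_real_power)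
  then have "mat_diag n (\<lambda>i. of_real ((singular_values X ! i)\<^sup>2)) = mat_diag n (\<lambda>i. es ! i)"
    by (intro eq_matI) (auto simp: mat_diag_def)
  moreover have "mat_adjoint (X * U) * (X * U) = mat_adjoint U * G * U"
  proof -
    have U': "mat_adjoint U \<in> carrier_mat n n" and XU: "X * U \<in> carrier_mat m n"
      using X U(1) by auto
    show ?thesis
      unfolding G_def mat_adjoint_mult[OF X U(1)] assoc_mult_mat[OF U' X' XU]
      using assoc_mult_mat[OF U' G(1) U(1)] assoc_mult_mat[OF X' X U(1)] by (simp add: G_def)
  qed
  ultimately have "mat_adjoint (X * U) * (X * U) = mat_diag n (\<lambda>i. of_real ((singular_values X ! i)\<^sup>2))"
    unfolding U(3) by simp
  moreover have "0 \<le> singular_values X ! i" if "i < n" for i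
    using that len e(2)[OF that] by (simp add: sv h_def)
  ultimately show ?thesis
    using U(1,2) by blast
qed

lemma singular_values_decreasing:
  assumes "i \<le> j" "j < dim_col X"
  shows "singular_values X ! j \<le> singular_values X ! i"
proof -
  have "sorted (rev (singular_values X))"
    by (simp add: singular_values_def)
  then have "sorted_wrt (\<ge>) (singular_values X)"
    by (simp add: sorted_wrt_rev)
  then show ?thesis
    using assms by (cases "i = j") (auto simp: sorted_wrt_iff_nth_less length_singular_values)
qed

text \<open>A vector supported on \<open>{..r}\<close> has enough freedom to annihilate \<open>r\<close> rows; the support condition is
  imposed by the unit rows of a square matrix whose row \<open>r\<close> is zero.\<close>

lemma kernel_vec_of_support:
  fixes G :: "complex mat"
  assumes G: "G \<in> carrier_mat m n" and rn: "r < n"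
  obtains c where "c \<in> carrier_vec n" "c \<noteq> 0\<^sub>v n" "\<And>i. r < i \<Longrightarrow> i < n \<Longrightarrow> c $ i = 0"
    "\<And>i. i < r \<Longrightarrow> i < m \<Longrightarrow> (G *\<^sub>v c) $ i = 0"
proof -
  \<comment> \<open>If \<open>m <= i < r\<close>, \<open>row G i\<close> has the right length but no
    meaningful entries; the conclusion about \<open>G\<close> is restricted to
    \<open>i < m\<close>.\<close>
  define row' where "row' = (\<lambda>i. if i < r then row G i else unit_vec n i)"
  define M where "M = mat\<^sub>r n n (\<lambda>i. if i = r then 0\<^sub>v n else row' i)"
  have "row' \<in> {0..<n} \<rightarrow> carrier_vec n"
    using G by (auto simp: row'_def)
  then have "det M = 0"
    unfolding M_def by (rule det_row_0[OF rn])
  moreover have M: "M \<in> carrier_mat n n"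
    by (simp add: M_def)
  ultimately obtain c where c: "c \<in> carrier_vec n" "c \<noteq> 0\<^sub>v n" "M *\<^sub>v c = 0\<^sub>v n"
    using det_0_iff_vec_prod_zero_field[OF M] by blast
  have rowc: "row' i \<bullet> c = 0" if "i < n" "i \<noteq> r" for i
  proof -
    have "row M i = row' i"
      using that G by (intro eq_vecI) (auto simp: M_def row'_def)
    moreover have "(M *\<^sub>v c) $ i = 0"
      using c(3) that by simp
    ultimately show ?thesis
      using M that by simp
  qed
  show thesis
  proof (rule that[OF c(1,2)])
    show "c $ i = 0" if "r < i" "i < n" for i
      using rowc[of i] that c(1) by (simp add: row'_def)
    show "(G *\<^sub>v c) $ i = 0" if "i < r" "i < m" for i
      using rowc[of i] that G rn by (simp add: row'_def)
  qed
qed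

text \<open>Pairwise orthogonal columns turn the inner product into a weighted coordinate sum. The
  weights are 1 for a unitary matrix and squared singular values for a matrix times its right
  singular vectors.\<close>

lemma cscalar_prod_gram:
  fixes W :: "complex mat"
  assumes W: "W \<in> carrier_mat m n" and D: "mat_adjoint W * W = mat_diag n f"
    and x: "x \<in> carrier_vec n" and y: "y \<in> carrier_vec n"
  shows "(W *\<^sub>v x) \<bullet>c (W *\<^sub>v y) = (\<Sum>i<n. f i * (x $ i * cnj (y $ i)))"
proof -
  have W': "mat_adjoint W \<in> carrier_mat n m" and Wx: "W *\<^sub>v x \<in> carrier_vec m"
    using W x by auto
  show ?thesis
    using cscalar_prod_congruence[OF one_carrier_mat W x y]
    by (simp add: right_mult_one_mat[OF W'] one_mult_mat_vec[OF Wx] D cscalar_prod_mat_diag[OF x y])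
qed

lemma cscalar_prod_append:
  fixes x y z w :: "complex vec"
  assumes "x \<in> carrier_vec n" "y \<in> carrier_vec m" "z \<in> carrier_vec n" "w \<in> carrier_vec m"
  shows "(x @\<^sub>v y) \<bullet>c (z @\<^sub>v w) = x \<bullet>c z + y \<bullet>c w"
proof -
  have "conjugate (z @\<^sub>v w) = conjugate z @\<^sub>v conjugate w"
    by (intro eq_vecI) auto
  then show ?thesis
    using assms by (simp add: scalar_prod_append[of _ n _ m])
qed

text \<open>The test vector \<open>z = (K U c', U c)\<close> below, with \<open>c'\<^sub>i = c\<^sub>i / s\<^sub>i\<close>, is a combination of the first \<open>j\<close> pairs
  of left and right singular vectors of \<open>K\<close>; it is chosen orthogonal to the first \<open>j - 1\<close> right
  singular vectors of \<open>H = M \<oplus> N\<close>. The conclusion is read off from \<open>0 \<le> |H z - s\<^sub>j(K) z|\<^sup>2\<close>, which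
  avoids comparing eigenvalues and singular values of \<open>H\<close>.\<close>

lemma singular_value_le_direct_sum:
  assumes K: "K \<in> carrier_mat n n" and M: "M \<in> carrier_mat n n" and N: "N \<in> carrier_mat n n"
    and form: "\<And>x y. x \<in> carrier_vec n \<Longrightarrow> y \<in> carrier_vec n \<Longrightarrow>
      2 * Re ((K *\<^sub>v y) \<bullet>c x) \<le> Re ((M *\<^sub>v x) \<bullet>c x) + Re ((N *\<^sub>v y) \<bullet>c y)"
    and j: "1 \<le> j" "j \<le> n"
  shows "singular_value j K \<le> singular_value j (M \<oplus>\<^sub>m N)"
proof -
  \<comment> \<open>List position of the \<open>j\<close>-th singular value, and also the number of
    orthogonality conditions imposed on the test vector.\<close>
  define r where "r = j - 1"
  have r: "r < n"
    using j by (simp add: r_def)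
  define H where "H = M \<oplus>\<^sub>m N"
  have H: "H \<in> carrier_mat (n + n) (n + n)"
    and H_block: "H = four_block_mat M (0\<^sub>m n n) (0\<^sub>m n n) N"
    using M N by (auto simp: H_def direct_sum_mat_def)
  define s where "s = (\<lambda>i. singular_values K ! i)"
  define t where "t = (\<lambda>i. singular_values H ! i)"
  obtain U where U: "U \<in> carrier_mat n n" "mat_adjoint U * U = 1\<^sub>m n"
    "mat_adjoint (K * U) * (K * U) = mat_diag n (\<lambda>i. of_real ((s i)\<^sup>2))"
    and s: "\<And>i. i < n \<Longrightarrow> 0 \<le> s i"
    unfolding s_def using singular_value_decomposition[OF K] by blast
  obtain V where V: "V \<in> carrier_mat (n + n) (n + n)" "mat_adjoint V * V = 1\<^sub>m (n + n)"
    "mat_adjoint (H * V) * (H * V) = mat_diag (n + n) (\<lambda>i. of_real ((t i)\<^sup>2))"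
    and t: "\<And>i. i < n + n \<Longrightarrow> 0 \<le> t i"
    unfolding t_def using singular_value_decomposition[OF H] by blast
  have "s r \<le> t r"
  \<comment> \<open>The test vector divides by \<open>s i\<close> for \<open>i <= r\<close>, so the
    trivial case of a vanishing singular value is treated apart.\<close>
  proof (cases "s r = 0")
    case True
    then show ?thesis
      using t[of r] r by simp
  next
    case False
    then have sr: "0 < s r"
      using s[OF r] by simp
    have s_ge: "s r \<le> s i" if "i \<le> r" for i
      using singular_values_decreasing[of i r K] that r K by (simp add: s_def)
    \<comment> \<open>For \<open>i > r\<close> the value \<open>s i\<close> may be 0, and then
      \<open>1 / s i\<close> is 0. This is harmless because \<open>c\<close> vanishes at those
      positions.\<close>
    define D where "D = mat_diag n (\<lambda>i. of_real (1 / s i) :: complex)"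
    \<comment> \<open>\<open>Z\<close> maps \<open>c\<close> linearly to the test vector
      \<open>z\<close>, so orthogonality to right singular vectors of \<open>H\<close> becomes a
      condition on rows of \<open>mat_adjoint V * Z\<close>.\<close>
    define Z where "Z = (K * U * D) @\<^sub>r U"
    have D: "D \<in> carrier_mat n n" and KU: "K * U \<in> carrier_mat n n"
      using K U by (auto simp: D_def)
    have KUD: "K * U * D \<in> carrier_mat n n"
      using KU D by simp
    have Z: "Z \<in> carrier_mat (n + n) n"
      unfolding Z_def using KUD U(1) by (rule carrier_append_rows)
    have V': "mat_adjoint V \<in> carrier_mat (n + n) (n + n)"
      using V(1) by simp
    obtain c where c: "c \<in> carrier_vec n" "c \<noteq> 0\<^sub>v n"
      and c0: "\<And>i. r < i \<Longrightarrow> i < n \<Longrightarrow> c $ i = 0"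
      and d0: "\<And>i. i < r \<Longrightarrow> i < n + n \<Longrightarrow> ((mat_adjoint V * Z) *\<^sub>v c) $ i = 0"
      using kernel_vec_of_support[OF mult_carrier_mat[OF V' Z] r] by metis
    define x' where "x' = D *\<^sub>v c"
    define x where "x = (K * U) *\<^sub>v x'"
    define y where "y = U *\<^sub>v c"
    define z where "z = x @\<^sub>v y"
    \<comment> \<open>The coordinates of \<open>z\<close> in the basis of right singular vectors of
      \<open>H\<close>; the first \<open>r\<close> of them are 0 by the choice of
      \<open>c\<close>.\<close>
    define d where "d = mat_adjoint V *\<^sub>v z"
    define C where "C = (\<Sum>i<n. (cmod (c $ i))\<^sup>2)"
    have x': "x' \<in> carrier_vec n" and x: "x \<in> carrier_vec n" and y: "y \<in> carrier_vec n"
      using D KU U(1) c(1) by (auto simp: x'_def x_def y_def)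
    have z: "z \<in> carrier_vec (n + n)" and d: "d \<in> carrier_vec (n + n)"
      using x y V' by (auto simp: z_def d_def)
    have x'_i: "x' $ i = c $ i / of_real (s i)" if "i < n" for i
      using mat_diag_mult_vec_index[OF c(1) that] by (simp add: x'_def D_def)
    \<comment> \<open>For \<open>i > r\<close> both sides are 0; for \<open>i <= r\<close> the
      divisor \<open>s i\<close> is positive.\<close>
    have c_i: "c $ i = of_real (s i) * x' $ i" if "i < n" for i
      using x'_i[OF that] c0[OF _ that] s_ge[of i] sr by (cases "r < i") auto
    have "c \<bullet>c c = of_real C"
      using cscalar_prod_self[of c] c(1) by (simp add: C_def)
    then have C: "0 < C"
      using Re_cscalar_prod_self_pos[OF c] by simp
    have yy: "y \<bullet>c y = of_real C"
      unfolding y_def C_def of_real_sum complex_norm_square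
      using cscalar_prod_gram[OF U(1), of "\<lambda>_. 1" c c] U(2) c(1) by simp
    have "x \<bullet>c x = (\<Sum>i<n. of_real ((s i)\<^sup>2) * (x' $ i * cnj (x' $ i)))"
      unfolding x_def by (rule cscalar_prod_gram[OF KU U(3) x' x'])
    also have "\<dots> = (\<Sum>i<n. of_real ((cmod (c $ i))\<^sup>2))"
    proof (rule sum.cong)
      fix i assume "i \<in> {..<n}"
      then show "of_real ((s i)\<^sup>2) * (x' $ i * cnj (x' $ i)) = (of_real ((cmod (c $ i))\<^sup>2) :: complex)"
        unfolding complex_norm_square by (simp add: c_i power2_eq_square)
    qed simp
    finally have xx: "x \<bullet>c x = of_real C"
      by (simp add: C_def)
    have Ky: "K *\<^sub>v y = (K * U) *\<^sub>v c"
      unfolding y_def using K U(1) c(1) by simp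
    have "(K *\<^sub>v y) \<bullet>c x = (\<Sum>i<n. of_real ((s i)\<^sup>2) * (c $ i * cnj (x' $ i)))"
      unfolding Ky x_def by (rule cscalar_prod_gram[OF KU U(3) c(1) x'])
    also have "\<dots> = (\<Sum>i<n. of_real (s i * (cmod (c $ i))\<^sup>2))"
    proof (rule sum.cong)
      fix i assume "i \<in> {..<n}"
      then show "of_real ((s i)\<^sup>2) * (c $ i * cnj (x' $ i)) = (of_real (s i * (cmod (c $ i))\<^sup>2) :: complex)"
        unfolding of_real_mult complex_norm_square by (simp add: c_i power2_eq_square)
    qed simp
    finally have "Re ((K *\<^sub>v y) \<bullet>c x) = (\<Sum>i<n. s i * (cmod (c $ i))\<^sup>2)"
      by simp
    also have "\<dots> \<ge> (\<Sum>i<n. s r * (cmod (c $ i))\<^sup>2)"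
    proof (rule sum_mono)
      fix i assume "i \<in> {..<n}"
      then show "s r * (cmod (c $ i))\<^sup>2 \<le> s i * (cmod (c $ i))\<^sup>2"
        using c0[of i] s_ge[of i] by (cases "r < i") (auto intro: mult_right_mono)
    qed
    finally have Kyx: "s r * C \<le> Re ((K *\<^sub>v y) \<bullet>c x)"
      by (simp add: C_def sum_distrib_left)
    have zz: "z \<bullet>c z = of_real (2 * C)"
      unfolding z_def cscalar_prod_append[OF x y x y] xx yy by simp
    have "H *\<^sub>v z = (M *\<^sub>v x) @\<^sub>v (N *\<^sub>v y)"
      unfolding H_block z_def using M N x y
      by (subst four_block_mat_mult_vec[of _ n n _ n _ n]) auto
    then have "(H *\<^sub>v z) \<bullet>c z = (M *\<^sub>v x) \<bullet>c x + (N *\<^sub>v y) \<bullet>c y"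
      unfolding z_def using M N x y by (simp add: cscalar_prod_append[of _ n _ n])
    \<comment> \<open>The hypothesis on the forms enters here. As \<open>z\<close> has squared
      length \<open>2 * C\<close>, the form of \<open>H\<close> at \<open>z\<close> is at least
      \<open>s r\<close> times that squared length.\<close>
    then have Hzz: "2 * s r * C \<le> Re ((H *\<^sub>v z) \<bullet>c z)"
      using form[OF x y] Kyx by simp
    have zd: "z = V *\<^sub>v d"
      unfolding d_def using V V' z unitary_right_inverse[OF V(1,2)]
      by (simp flip: assoc_mult_mat_vec[of V "n + n" "n + n" "mat_adjoint V" "n + n"])
    have "Z *\<^sub>v c = z"
      unfolding Z_def z_def x_def y_def x'_def mat_mult_append[OF KUD U(1) c(1)]
      using KU D c(1) by simp
    then have "d = (mat_adjoint V * Z) *\<^sub>v c"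
      unfolding d_def using assoc_mult_mat_vec[OF V' Z c(1)] by simp
    then have d_i: "d $ i = 0" if "i < r" for i
      using d0[of i] that r by simp
    have "z \<bullet>c z = (\<Sum>i<n + n. of_real ((cmod (d $ i))\<^sup>2))"
      unfolding zd complex_norm_square
      using cscalar_prod_gram[OF V(1), of "\<lambda>_. 1" d d] V(2) d by simp
    then have dd: "(\<Sum>i<n + n. (cmod (d $ i))\<^sup>2) = 2 * C"
      unfolding zz of_real_sum[symmetric] of_real_eq_iff by simp
    have HV: "H * V \<in> carrier_mat (n + n) (n + n)"
      using H V(1) by simp
    have Hz: "H *\<^sub>v z = (H * V) *\<^sub>v d"
      unfolding zd using H V(1) d by simp
    have "(H *\<^sub>v z) \<bullet>c (H *\<^sub>v z) = (\<Sum>i<n + n. of_real ((t i)\<^sup>2) * (d $ i * cnj (d $ i)))"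
      unfolding Hz by (rule cscalar_prod_gram[OF HV V(3) d d])
    also have "\<dots> = of_real (\<Sum>i<n + n. (t i)\<^sup>2 * (cmod (d $ i))\<^sup>2)"
      unfolding complex_norm_square[symmetric] by simp
    finally have "Re ((H *\<^sub>v z) \<bullet>c (H *\<^sub>v z)) = (\<Sum>i<n + n. (t i)\<^sup>2 * (cmod (d $ i))\<^sup>2)"
      by simp
    also have "\<dots> \<le> (\<Sum>i<n + n. (t r)\<^sup>2 * (cmod (d $ i))\<^sup>2)"
    proof (rule sum_mono)
      fix i assume i: "i \<in> {..<n + n}"
      show "(t i)\<^sup>2 * (cmod (d $ i))\<^sup>2 \<le> (t r)\<^sup>2 * (cmod (d $ i))\<^sup>2"
      \<comment> \<open>Where \<open>t i\<close> might exceed \<open>t r\<close>, the coordinate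
        \<open>d $ i\<close> vanishes; elsewhere the decreasing order applies.\<close>
      proof (cases "i < r")
        case False
        then have "t i \<le> t r"
          using singular_values_decreasing[of r i H] i H by (simp add: t_def)
        then show ?thesis
          using t[of i] i by (intro mult_right_mono power_mono) auto
      qed (simp add: d_i)
    qed
    finally have HzHz: "Re ((H *\<^sub>v z) \<bullet>c (H *\<^sub>v z)) \<le> (t r)\<^sup>2 * (2 * C)"
      by (simp add: dd flip: sum_distrib_left)
    define w where "w = H *\<^sub>v z - of_real (s r) \<cdot>\<^sub>v z"
    have dims: "dim_vec z = n + n" "dim_row H = n + n"
      using z H by auto
    have zHz: "z \<bullet>c (H *\<^sub>v z) = cnj ((H *\<^sub>v z) \<bullet>c z)"
      using H z by (intro cscalar_prod_swap[of _ "n + n"]) auto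
    have "0 \<le> Re (w \<bullet>c w)"
      unfolding cscalar_prod_self by (simp add: sum_nonneg)
    also have "Re (w \<bullet>c w) = Re ((H *\<^sub>v z) \<bullet>c (H *\<^sub>v z)) - 2 * s r * Re ((H *\<^sub>v z) \<bullet>c z) + s r * s r * (2 * C)"
      unfolding w_def by (simp add: cscalar_prod_simps dims zz zHz algebra_simps)
    also have "\<dots> \<le> (t r)\<^sup>2 * (2 * C) - 2 * s r * (2 * s r * C) + s r * s r * (2 * C)"
    proof -
      have "2 * s r * (2 * s r * C) \<le> 2 * s r * Re ((H *\<^sub>v z) \<bullet>c z)"
        using Hzz sr by (intro mult_left_mono) auto
      then show ?thesis
        using HzHz by linarith
    qed
    also have "\<dots> = 2 * C * ((t r)\<^sup>2 - (s r)\<^sup>2)"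
      by (simp add: power2_eq_square algebra_simps)
    finally have "(s r)\<^sup>2 \<le> (t r)\<^sup>2"
      using C by (simp add: zero_le_mult_iff)
    then show ?thesis
      using t[of r] r by (auto intro: power2_le_imp_le)
  qed
  then show ?thesis
    by (simp add: singular_value_def s_def t_def H_def r_def)
qed

section \<open>The absolute values of a matrix and of its adjoint\<close>

lemma sqrt_mat_gram_adjoint:
  fixes X :: "complex mat"
  assumes X: "X \<in> carrier_mat n n" and d: "det (mat_adjoint X * X) \<noteq> 0"
  shows "sqrt_mat (X * mat_adjoint X) = X * inv_mat (sqrt_mat (mat_adjoint X * X)) * mat_adjoint X"
proof -
  define R where "R = sqrt_mat (mat_adjoint X * X)"
  have X': "mat_adjoint X \<in> carrier_mat n n"
    using X by simp
  have XX: "mat_adjoint X * X \<in> carrier_mat n n"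
    using X X' by simp
  note R = sqrt_mat[OF XX pos_semidef_gram[OF X], folded R_def]
  have dR: "det R \<noteq> 0"
    unfolding R_def by (rule det_sqrt_mat_nonzero[OF XX pos_semidef_gram[OF X] d])
  note I = inv_mat[OF R(1) dR]
  note assoc = assoc_mult_mat[of _ n n _ n _ n]
  show ?thesis
    unfolding R_def[symmetric]
  proof (rule sqrt_mat_eqI)
    show "X * inv_mat R * mat_adjoint X \<in> carrier_mat n n"
      using X X' I(1) by simp
    show "pos_semidef_mat (X * inv_mat R * mat_adjoint X)"
      using pos_semidef_congruence[OF I(1) pos_semidef_inv_mat[OF R(1,2) dR] X'] by simp
    \<comment> \<open>The inner product of adjoint and matrix is \<open>R * R\<close>, which the two
      neighbouring inverses of \<open>R\<close> cancel. Thus the candidate squares to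
      \<open>X * mat_adjoint X\<close>.\<close>
    have "X * inv_mat R * mat_adjoint X * (X * inv_mat R * mat_adjoint X)
        = X * (inv_mat R * (mat_adjoint X * X) * inv_mat R) * mat_adjoint X"
      using X X' I(1) by (simp add: assoc)
    also have "inv_mat R * (mat_adjoint X * X) * inv_mat R = (inv_mat R * R) * (R * inv_mat R)"
      unfolding R(3)[symmetric] using R(1) I(1) by (simp add: assoc)
    finally show "X * inv_mat R * mat_adjoint X * (X * inv_mat R * mat_adjoint X) = X * mat_adjoint X"
      using X I by simp
  qed
qed

text \<open>Positivity of the block matrix with diagonal blocks \<open>|X\<^sup>*|\<close>, \<open>|X|\<close>
  and off-diagonal blocks \<open>X\<close>, \<open>X\<^sup>*\<close> (up to the sign of one coordinate).\<close>

lemma cscalar_prod_le_abs: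
  fixes X :: "complex mat"
  assumes X: "X \<in> carrier_mat n n" and d: "det (mat_adjoint X * X) \<noteq> 0"
    and a: "a \<in> carrier_vec n" and b: "b \<in> carrier_vec n"
  shows "2 * Re ((X *\<^sub>v b) \<bullet>c a) \<le>
    Re ((sqrt_mat (X * mat_adjoint X) *\<^sub>v a) \<bullet>c a) + Re ((sqrt_mat (mat_adjoint X * X) *\<^sub>v b) \<bullet>c b)"
proof -
  define R where "R = sqrt_mat (mat_adjoint X * X)"
  have X': "mat_adjoint X \<in> carrier_mat n n"
    using X by simp
  have XX: "mat_adjoint X * X \<in> carrier_mat n n"
    using X X' by simp
  note R = sqrt_mat[OF XX pos_semidef_gram[OF X], folded R_def]
  have adjR: "mat_adjoint R = R"
    unfolding R_def by (rule mat_adjoint_sqrt_mat[OF XX pos_semidef_gram[OF X]])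
  have dR: "det R \<noteq> 0"
    unfolding R_def by (rule det_sqrt_mat_nonzero[OF XX pos_semidef_gram[OF X] d])
  note I = inv_mat[OF R(1) dR]
  define w where "w = mat_adjoint X *\<^sub>v a"
  \<comment> \<open>With this \<open>u\<close> the form of \<open>|X*|\<close> at \<open>a\<close>
    becomes the form of \<open>R = |X|\<close> at \<open>u\<close>, and the mixed term becomes
    \<open>(R *\<^sub>v b) \<bullet>c u\<close>. The claim is then positivity of \<open>R\<close> at
    \<open>u - b\<close>.\<close>
  define u where "u = inv_mat R *\<^sub>v w"
  have w: "w \<in> carrier_vec n"
    using X' a by (simp add: w_def)
  have u: "u \<in> carrier_vec n"
    using I(1) w by (simp add: u_def)
  have XI: "X * inv_mat R \<in> carrier_mat n n"
    using X I(1) by simp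
  have Ru: "R *\<^sub>v u = w"
    unfolding u_def assoc_mult_mat_vec[OF R(1) I(1) w, symmetric] I(2) using w by simp
  have "(sqrt_mat (X * mat_adjoint X) *\<^sub>v a) \<bullet>c a = (X *\<^sub>v u) \<bullet>c a"
    unfolding sqrt_mat_gram_adjoint[OF X d] R_def[symmetric] u_def assoc_mult_mat_vec[OF XI X' a]
      w_def[symmetric] assoc_mult_mat_vec[OF X I(1) w] ..
  also have "\<dots> = u \<bullet>c (R *\<^sub>v u)"
    unfolding Ru w_def by (rule cscalar_prod_mat_adjoint[OF X u a])
  also have "\<dots> = (R *\<^sub>v u) \<bullet>c u"
    using cscalar_prod_mat_adjoint[OF R(1) u u] by (simp add: adjR)
  finally have 1: "(sqrt_mat (X * mat_adjoint X) *\<^sub>v a) \<bullet>c a = (R *\<^sub>v u) \<bullet>c u" .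
  have 2: "(X *\<^sub>v b) \<bullet>c a = (R *\<^sub>v b) \<bullet>c u"
    using cscalar_prod_mat_adjoint[OF X b a] cscalar_prod_mat_adjoint[OF R(1) b u]
    by (simp add: adjR Ru flip: w_def)
  have "(R *\<^sub>v u) \<bullet>c b = u \<bullet>c (R *\<^sub>v b)"
    using cscalar_prod_mat_adjoint[OF R(1) u b] by (simp add: adjR)
  also have "\<dots> = cnj ((R *\<^sub>v b) \<bullet>c u)"
    using R(1) u b by (intro cscalar_prod_swap[of _ n]) auto
  finally have 3: "(R *\<^sub>v u) \<bullet>c b = cnj ((R *\<^sub>v b) \<bullet>c u)" .
  have dims: "dim_vec u = n" "dim_vec b = n" "dim_row R = n"
    using u b R(1) by auto
  have ub: "u - b \<in> carrier_vec n"
    using u b by simp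
  have "0 \<le> Re ((R *\<^sub>v (u - b)) \<bullet>c (u - b))"
    using R(1,2) ub by (simp add: pos_semidef_mat_iff)
  also have "(R *\<^sub>v (u - b)) \<bullet>c (u - b)
      = (R *\<^sub>v u) \<bullet>c u - (R *\<^sub>v u) \<bullet>c b - ((R *\<^sub>v b) \<bullet>c u - (R *\<^sub>v b) \<bullet>c b)"
    unfolding mult_minus_distrib_mat_vec[OF R(1) u b] by (simp add: cscalar_prod_simps dims)
  finally show ?thesis
    unfolding R_def[symmetric] 1 2 3 by simp
qed

section \<open>Application to the two means\<close>

theorem theorem2p3:
  fixes A B :: "complex mat" and n j :: nat
  assumes "A \<in> carrier_mat n n" and "B \<in> carrier_mat n n"
    and "pos_def_mat A" and "pos_def_mat B"
    and "1 \<le> j" and "j \<le> n"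
  shows "singular_value j (sqrt_mat A * sqrt_mat B)
       \<le> singular_value j ((A \<natural> B) \<oplus>\<^sub>m (A \<sharp> B))"
proof -
  have psd: "pos_semidef_mat A" "pos_semidef_mat B"
    using assms(3,4) by (simp_all add: pos_def_imp_pos_semidef)
  have dA: "det A \<noteq> 0" and dB: "det B \<noteq> 0"
    using assms by (auto simp: pos_def_det_nonzero)
  define P where "P = sqrt_mat A"
  define Q where "Q = sqrt_mat B"
  note P = sqrt_mat[OF assms(1) psd(1), folded P_def]
  note Q = sqrt_mat[OF assms(2) psd(2), folded Q_def]
  have adjP: "mat_adjoint P = P" and adjQ: "mat_adjoint Q = Q"
    unfolding P_def Q_def using assms(1,2) psd by (simp_all add: mat_adjoint_sqrt_mat)
  have dP: "det P \<noteq> 0"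
    unfolding P_def by (rule det_sqrt_mat_nonzero[OF assms(1) psd(1) dA])
  note I = inv_mat[OF P(1) dP]
  have adjI: "mat_adjoint (inv_mat P) = inv_mat P"
    by (rule mat_adjoint_inv_mat[OF P(1) dP adjP])
  note assoc = assoc_mult_mat[of _ n n _ n _ n]
  define X where "X = Q * inv_mat P"
  have X: "X \<in> carrier_mat n n"
    using Q(1) I(1) by (simp add: X_def)
  have adjX: "mat_adjoint X = inv_mat P * Q"
    unfolding X_def mat_adjoint_mult[OF Q(1) I(1)] adjI adjQ by simp
  \<comment> \<open>This is the matrix under the inner root of \<open>A \<sharp> B\<close>; the
    opposite product \<open>X * mat_adjoint X\<close> will be the one in
    \<open>A \<natural> B\<close>.\<close>
  have X'X: "mat_adjoint X * X = inv_mat P * B * inv_mat P"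
    unfolding adjX unfolding X_def Q(3)[symmetric] using Q(1) I(1) by (simp add: assoc)
  have "inv_mat A = inv_mat P * inv_mat P"
  proof (rule inv_mat_eqI[OF assms(1)])
    have "A * (inv_mat P * inv_mat P) = P * (P * inv_mat P) * inv_mat P"
      unfolding P(3)[symmetric] using P(1) I(1) by (simp add: assoc)
    then show "A * (inv_mat P * inv_mat P) = 1\<^sub>m n"
      using P(1) I by simp
  qed (use I(1) in simp)
  then have XX': "X * mat_adjoint X = Q * inv_mat A * Q"
    unfolding adjX unfolding X_def using Q(1) I(1) by (simp add: assoc)
  \<comment> \<open>It follows that \<open>inv_mat P\<close> has nonzero determinant, so the
    invertible \<open>B\<close> keeps \<open>mat_adjoint X * X\<close> invertible.\<close>
  have "det P * det (inv_mat P) = 1"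
    using det_mult[OF P(1) I(1)] I(2) by simp
  then have dX: "det (mat_adjoint X * X) \<noteq> 0"
    unfolding X'X using I(1) assms(2) dB by (auto simp: det_mult[of _ n])
  define S where "S = sqrt_mat (mat_adjoint X * X)"
  define T where "T = sqrt_mat (X * mat_adjoint X)"
  have S: "S \<in> carrier_mat n n"
    unfolding S_def using X by (intro sqrt_mat pos_semidef_gram) simp_all
  have T: "T \<in> carrier_mat n n"
    unfolding T_def using X pos_semidef_gram[of "mat_adjoint X" n n] by (intro sqrt_mat) simp_all
  have "A \<sharp> B = P * S * P" "A \<natural> B = P * T * P"
    unfolding geometric_mean_def natural_mean_def P_def[symmetric] Q_def[symmetric] S_def T_def X'X XX'
    by simp_all
  moreover have K: "P * Q = P * X * P"
    unfolding X_def using P(1) Q(1) I by (simp add: assoc)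
  moreover have "singular_value j (P * X * P) \<le> singular_value j ((P * T * P) \<oplus>\<^sub>m (P * S * P))"
  proof (rule singular_value_le_direct_sum[of _ n])
    fix x y :: "complex vec" assume x: "x \<in> carrier_vec n" and y: "y \<in> carrier_vec n"
    have "P *\<^sub>v x \<in> carrier_vec n" "P *\<^sub>v y \<in> carrier_vec n"
      using P(1) x y by simp_all
    note le = cscalar_prod_le_abs[OF X dX this, folded S_def T_def]
    \<comment> \<open>Since \<open>P\<close> is Hermitian, \<open>P * Y * P\<close> is a congruence.
      Evaluating the inequality for \<open>X\<close> at \<open>P *\<^sub>v x\<close> and
      \<open>P *\<^sub>v y\<close> therefore gives the required one.\<close>
    have "((P * Y * P) *\<^sub>v v) \<bullet>c w = (Y *\<^sub>v (P *\<^sub>v v)) \<bullet>c (P *\<^sub>v w)"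
      if "Y \<in> carrier_mat n n" "v \<in> carrier_vec n" "w \<in> carrier_vec n" for Y v w
      using cscalar_prod_congruence[OF that(1) P(1) that(2,3)] by (simp add: adjP)
    then show "2 * Re (((P * X * P) *\<^sub>v y) \<bullet>c x) \<le>
        Re (((P * T * P) *\<^sub>v x) \<bullet>c x) + Re (((P * S * P) *\<^sub>v y) \<bullet>c y)"
      using le X S T x y by simp
  qed (use P(1) X S T assms(5,6) in simp_all)
  ultimately show ?thesis
    by (simp add: P_def Q_def)
qed

end
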